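(* Let $\mathcal{R}_1=\{W_w,V_{w,v},\Lambda_w,\alpha_{w,v}\}_{w\in\Omega,v\in\Omega_w}$ be a continuous relay fusion frame for $H$ with bounds $A$ and $B$. Suppose that $\{Z_{w,v}\}_{v\in\Omega_w}$ is a family of closed subspaces of $K_w$ for each $w\in\Omega$ and that there exist constants $C,D,\epsilon$ such that $\max\{C+\frac{\epsilon}{\sqrt A},D\}<1$ and for all $f\in H$ $$\Big(\int_\Omega\int_{\Omega_w}\alpha_{w,v}^2\|P_{V_{w,v}}\Lambda_w\pi_{W_w}f-P_{Z_{w,v}}\Lambda_w\pi_{W_w}f\|^2d\mu(v)d\mu(w)\Big)^{1/2}$$ $$\le C\Big(\int_\Omega\int_{\Omega_w}\alpha_{w,v}^2\|P_{V_{w,v}}\Lambda_w\pi_{W_w}f\|^2d\mu(v)d\mu(w)\Big)^{1/2}+D\Big(\int_\Omega\int_{\Omega_w}\alpha_{w,v}^2\|P_{Z_{w,v}}\Lambda_w\pi_{W_w}f\|^2d\mu(v)d\mu(w)\Big)^{1/2}+\epsilon\|f\|.$$ Then $\mathcal{R}_2=\{W_w,Z_{w,v},\Lambda_w,\alpha_{w,v}\}_{w\in\Omega,v\in\Omega_w}$ is a continuous relay fusion frame for $H$ with bounds $$A\Big(\frac{1-C-\frac{\epsilon}{\sqrt A}}{1+D}\Big)^2,\qquad B\Big(\frac{1+C+\frac{\epsilon}{\sqrt B}}{1-D}\Big)^2.$$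
   Context: Setting. $H$ is a separable Hilbert space and $(\Omega,\mu)$ is a positive measure space; for each $w\in\Omega$, $\Omega_w$ is a positive measure space whose measure is also denoted $\mu$. For each $w\in\Omega$, $K_w$ is a separable Hilbert space, $W_w\subseteq H$ is a closed subspace, $\Lambda_w\in B(H,K_w)$, and $\{V_{w,v}\}_{v\in\Omega_w}$ is a family of closed subspaces of $K_w$; $\alpha_{w,v}>0$ are weights. $\pi_W$ and $P_V$ denote orthogonal projections onto closed subspaces $W$ of $H$ and $V$ of $K_w$. Families of subspaces, operators and weights are understood to be measurable (in the sense of (1)–(3) below) so that the integrals written make sense. Definition. $\mathcal{R}=\{W_w,V_{w,v},\Lambda_w,\alpha_{w,v}\}_{w\in\Omega,v\in\Omega_w}$ is a continuous relay fusion frame for $H$ with (lower and upper) bounds $A,B$ if: (1) for each $f\in H$, $\{\Lambda_wf\}_{w\in\Omega}$ is strongly measurable; (2) for each $f\in H$, $\{\pi_{W_w}f\}_{w\in\Omega}$ is strongly measurable; (3) for each $f\in K_w$, $\{P_{V_{w,v}}f\}_{w\in\Omega,v\in\Omega_w}$ is strongly measurable; (4) the constants $0<A\le B<\infty$ satisfy $$A\|f\|^2\le\int_\Omega\int_{\Omega_w}\alpha_{w,v}^2\|P_{V_{w,v}}\Lambda_w\pi_{W_w}f\|^2\,d\mu(v)\,d\mu(w)\le B\|f\|^2\quad\forall f\in H.$$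
   Formalization: The constants C, D, ε are assumed nonnegative (for arbitrary real constants the claim fails, e.g. C=1.5, D=0, ε=−1), and the left-hand integral of the perturbation inequality is assumed finite (otherwise ∞≤∞ is a counterexample). *)

theory Defs
  imports "HOL-Analysis.Analysis"
begin

text \<open>
  Hilbert spaces are taken over the reals. This includes the complex case by restriction of scalars,
  with real inner product Re: norms, closed subspaces, bounded operators and orthogonal projections
  of a complex Hilbert space are the same, or special cases of the same, for the underlying real one.

  The spaces \<open>K w\<close> vary with \<open>w\<close>. They are closed subspaces of one ambient Hilbert space \<open>'k\<close>, which
  need not be separable (it can be the Hilbert sum of a given family). Without a common ambient space
  strong measurability of \<open>w \<mapsto> \<Lambda> w f\<close> would have no meaning. Likewise the measure spaces \<open>\<Omega>' w\<close>
  may have different underlying sets, all inside one type \<open>'v\<close>.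
\<close>

definition closed_subspace :: "'a::real_normed_vector set \<Rightarrow> bool" where
  "closed_subspace S \<longleftrightarrow> subspace S \<and> closed S"

text \<open>Meaningful for closed subspaces of a Hilbert space, where the projection exists uniquely.\<close>

definition orth_proj :: "'a::real_inner set \<Rightarrow> 'a \<Rightarrow> 'a" where
  "orth_proj S x = (THE y. y \<in> S \<and> (\<forall>z\<in>S. (x - y) \<bullet> z = 0))"

text \<open>
  As usual in the library, measurability is required everywhere and not just almost everywhere.
  If the target is separable, this is the same as Borel measurability.
\<close>

definition strongly_measurable :: "'a measure \<Rightarrow> ('a \<Rightarrow> 'b::real_normed_vector) \<Rightarrow> bool" where
  "strongly_measurable M f \<longleftrightarrow>
     (\<exists>s. (\<forall>i. simple_function M (s i)) \<and> (\<forall>x\<in>space M. (\<lambda>i::nat. s i x) \<longlonglongrightarrow> f x))"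

definition subspace_family ::
  "'w measure \<Rightarrow> ('w \<Rightarrow> 'v measure) \<Rightarrow> ('w \<Rightarrow> 'k::real_normed_vector set) \<Rightarrow>
   ('w \<Rightarrow> 'v \<Rightarrow> 'k set) \<Rightarrow> bool" where
  "subspace_family \<Omega> \<Omega>' K V \<longleftrightarrow>
     (\<forall>w\<in>space \<Omega>. \<forall>v\<in>space (\<Omega>' w). closed_subspace (V w v) \<and> V w v \<subseteq> K w)"

definition relay_system ::
  "'w measure \<Rightarrow> ('w \<Rightarrow> 'v measure) \<Rightarrow> ('w \<Rightarrow> 'k::{real_inner,complete_space} set) \<Rightarrow>
   ('w \<Rightarrow> 'h::{real_inner,complete_space,second_countable_topology} set) \<Rightarrow>
   ('w \<Rightarrow> 'v \<Rightarrow> 'k set) \<Rightarrow> ('w \<Rightarrow> 'h \<Rightarrow> 'k) \<Rightarrow> ('w \<Rightarrow> 'v \<Rightarrow> real) \<Rightarrow> bool" where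
  "relay_system \<Omega> \<Omega>' K W V \<Lambda> \<alpha> \<longleftrightarrow>
     (\<forall>w\<in>space \<Omega>.
        closed_subspace (K w) \<and> separable_space (top_of_set (K w)) \<and>
        closed_subspace (W w) \<and>
        bounded_linear (\<Lambda> w) \<and> range (\<Lambda> w) \<subseteq> K w \<and>
        \<alpha> w \<in> borel_measurable (\<Omega>' w) \<and> (\<forall>v\<in>space (\<Omega>' w). 0 < \<alpha> w v)) \<and>
     subspace_family \<Omega> \<Omega>' K V"

text \<open>
  Since the vector ranges over \<open>K w\<close>, strong measurability of \<open>P\<^bsub>V w v\<^esub> g\<close> is a condition on the
  function of \<open>v\<close>, for each \<open>w\<close>.
\<close>

definition projections_measurable ::
  "'w measure \<Rightarrow> ('w \<Rightarrow> 'v measure) \<Rightarrow> ('w \<Rightarrow> 'k::real_inner set) \<Rightarrow>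
   ('w \<Rightarrow> 'v \<Rightarrow> 'k set) \<Rightarrow> bool" where
  "projections_measurable \<Omega> \<Omega>' K V \<longleftrightarrow>
     (\<forall>w\<in>space \<Omega>. \<forall>g\<in>K w. strongly_measurable (\<Omega>' w) (\<lambda>v. orth_proj (V w v) g))"

definition relay_analysis ::
  "('w \<Rightarrow> 'h::real_inner set) \<Rightarrow> ('w \<Rightarrow> 'v \<Rightarrow> 'k::real_inner set) \<Rightarrow> ('w \<Rightarrow> 'h \<Rightarrow> 'k) \<Rightarrow>
   'h \<Rightarrow> 'w \<Rightarrow> 'v \<Rightarrow> 'k" where
  "relay_analysis W V \<Lambda> f w v = orth_proj (V w v) (\<Lambda> w (orth_proj (W w) f))"

definition inner_integral ::
  "('w \<Rightarrow> 'v measure) \<Rightarrow> ('w \<Rightarrow> 'v \<Rightarrow> real) \<Rightarrow> ('w \<Rightarrow> 'v \<Rightarrow> 'k::real_normed_vector) \<Rightarrow>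
   'w \<Rightarrow> ennreal" where
  "inner_integral \<Omega>' \<alpha> F w = (\<integral>\<^sup>+ v. ennreal ((\<alpha> w v)\<^sup>2 * (norm (F w v))\<^sup>2) \<partial>\<Omega>' w)"

definition iterated_integral ::
  "'w measure \<Rightarrow> ('w \<Rightarrow> 'v measure) \<Rightarrow> ('w \<Rightarrow> 'v \<Rightarrow> real) \<Rightarrow>
   ('w \<Rightarrow> 'v \<Rightarrow> 'k::real_normed_vector) \<Rightarrow> ennreal" where
  "iterated_integral \<Omega> \<Omega>' \<alpha> F = (\<integral>\<^sup>+ w. inner_integral \<Omega>' \<alpha> F w \<partial>\<Omega>)"

text \<open>
  The measurability of the inner integral as a function of \<open>w\<close>, without which the iterated integral
  makes no sense, is a separate requirement: no measurable structure on the disjoint union of the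
  \<open>\<Omega>' w\<close> is given from which it could be derived. For fixed \<open>w\<close>, in contrast, the inner integrand is
  measurable because of \<open>projections_measurable\<close> and the measurability of \<open>\<alpha> w\<close>.
\<close>

definition continuous_relay_fusion_frame ::
  "'w measure \<Rightarrow> ('w \<Rightarrow> 'v measure) \<Rightarrow> ('w \<Rightarrow> 'k::{real_inner,complete_space} set) \<Rightarrow>
   ('w \<Rightarrow> 'h::{real_inner,complete_space,second_countable_topology} set) \<Rightarrow>
   ('w \<Rightarrow> 'v \<Rightarrow> 'k set) \<Rightarrow> ('w \<Rightarrow> 'h \<Rightarrow> 'k) \<Rightarrow> ('w \<Rightarrow> 'v \<Rightarrow> real) \<Rightarrow> real \<Rightarrow> real \<Rightarrow> bool" where
  "continuous_relay_fusion_frame \<Omega> \<Omega>' K W V \<Lambda> \<alpha> A B \<longleftrightarrow>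
     relay_system \<Omega> \<Omega>' K W V \<Lambda> \<alpha> \<and>
     (\<forall>f. strongly_measurable \<Omega> (\<lambda>w. \<Lambda> w f)) \<and>
     (\<forall>f. strongly_measurable \<Omega> (\<lambda>w. orth_proj (W w) f)) \<and>
     projections_measurable \<Omega> \<Omega>' K V \<and>
     (\<forall>f. inner_integral \<Omega>' \<alpha> (relay_analysis W V \<Lambda> f) \<in> borel_measurable \<Omega>) \<and>
     0 < A \<and> A \<le> B \<and>
     (\<forall>f. ennreal (A * (norm f)\<^sup>2) \<le> iterated_integral \<Omega> \<Omega>' \<alpha> (relay_analysis W V \<Lambda> f) \<and>
          iterated_integral \<Omega> \<Omega>' \<alpha> (relay_analysis W V \<Lambda> f) \<le> ennreal (B * (norm f)\<^sup>2))"

end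

theory Submission
  imports Defs
begin

text \<open>
  The iterated integrals are squares of \<open>L\<^sup>2\<close>-type seminorms, so the perturbation bound
  \<open>d \<le> C x + D y + \<epsilon> \<parallel>f\<parallel>\<close> together with the triangle inequalities \<open>x \<le> y + d\<close>, \<open>y \<le> x + d\<close> and
  \<open>sqrt A \<parallel>f\<parallel> \<le> x \<le> sqrt B \<parallel>f\<parallel>\<close> gives both frame bounds. There is no product measure on the
  disjoint union of the \<open>\<Omega>' w\<close>, so Minkowski's inequality is obtained by integrating
  \<open>(a + b)\<^sup>2 \<le> (1 + t) a\<^sup>2 + (1 + 1/t) b\<^sup>2\<close> twice and then optimising over \<open>t > 0\<close>.
\<close>

section \<open>Strong measurability and norms\<close>

lemma strongly_measurable_diff:
  assumes "strongly_measurable M f" "strongly_measurable M g"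
  shows "strongly_measurable M (\<lambda>x. f x - g x)"
proof -
  obtain s where s: "\<And>i. simple_function M (s i)"
    "\<And>x. x \<in> space M \<Longrightarrow> (\<lambda>i::nat. s i x) \<longlonglongrightarrow> f x"
    using assms(1) unfolding strongly_measurable_def by blast
  obtain t where t: "\<And>i. simple_function M (t i)"
    "\<And>x. x \<in> space M \<Longrightarrow> (\<lambda>i::nat. t i x) \<longlonglongrightarrow> g x"
    using assms(2) unfolding strongly_measurable_def by blast
  show ?thesis
    unfolding strongly_measurable_def
  proof (intro exI[of _ "\<lambda>i x. s i x - t i x"] conjI allI ballI)
    fix i show "simple_function M (\<lambda>x. s i x - t i x)"
      using s(1) t(1) by (rule simple_function_compose2)
  qed (intro tendsto_diff s t)
qed

text \<open>Only norms enter the integrals, so real-valued measurability is enough for them.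
  Differences are formed before taking norms, on the level of simple functions: in a nonseparable
  space, Borel measurability of two functions does not in general pass to their difference.\<close>

lemma strongly_measurable_norm:
  assumes "strongly_measurable M f"
  shows "(\<lambda>x. norm (f x)) \<in> borel_measurable M"
proof -
  obtain s where s: "\<And>i. simple_function M (s i)"
    "\<And>x. x \<in> space M \<Longrightarrow> (\<lambda>i::nat. s i x) \<longlonglongrightarrow> f x"
    using assms unfolding strongly_measurable_def by blast
  show ?thesis
  proof (rule borel_measurable_LIMSEQ_real)
    fix i
    show "(\<lambda>x. norm (s i x)) \<in> borel_measurable M"
      by (intro borel_measurable_simple_function simple_function_compose1[OF s(1)])
  qed (rule tendsto_norm[OF s(2)])
qed

section \<open>Minkowski's inequality for iterated integrals\<close>

lemma power2_sum_le_weighted: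
  fixes a b t :: real
  assumes "0 < t"
  shows "(a + b)\<^sup>2 \<le> (1 + t) * a\<^sup>2 + (1 + 1 / t) * b\<^sup>2"
proof -
  have "0 \<le> (t * a - b)\<^sup>2 / t"
    using assms by simp
  also have "\<dots> = (1 + t) * a\<^sup>2 + (1 + 1 / t) * b\<^sup>2 - (a + b)\<^sup>2"
    using assms by (simp add: field_simps power2_eq_square)
  finally show ?thesis by simp
qed

text \<open>For positive \<open>x\<close> and \<open>z\<close> the choice
  \<open>t = sqrt z / sqrt x\<close> turns the right-hand side into
  \<open>(sqrt x + sqrt z)\<^sup>2\<close>. To cover vanishing \<open>x\<close> or \<open>z\<close>
  as well, both roots are first enlarged by \<open>e / 2\<close>, and \<open>e\<close> is
  arbitrary.\<close>

lemma sqrt_le_add_sqrt_if_weighted: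
  fixes x y z :: real
  assumes "0 \<le> x" "0 \<le> z"
    and weighted: "\<And>t. 0 < t \<Longrightarrow> y \<le> (1 + t) * x + (1 + 1 / t) * z"
  shows "sqrt y \<le> sqrt x + sqrt z"
proof (rule field_le_epsilon)
  fix e :: real
  assume "0 < e"
  define a b where "a = sqrt x + e / 2" and "b = sqrt z + e / 2"
  have pos: "0 < a" "0 < b"
    using assms(1,2) \<open>0 < e\<close> by (simp_all add: a_def b_def add_nonneg_pos)
  have "x \<le> a\<^sup>2" "z \<le> b\<^sup>2"
    using assms(1,2) \<open>0 < e\<close> by (auto simp: a_def b_def intro!: sqrt_le_D)
  then have "(1 + b / a) * x + (1 + a / b) * z \<le> (1 + b / a) * a\<^sup>2 + (1 + a / b) * b\<^sup>2"
    using pos by (intro add_mono mult_left_mono) auto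
  also have "\<dots> = (a + b)\<^sup>2"
    using pos by (simp add: field_simps power2_eq_square)
  finally have "y \<le> (a + b)\<^sup>2"
    using weighted[of "b / a"] pos by simp
  then have "sqrt y \<le> a + b"
    using pos by (intro real_le_lsqrt) auto
  then show "sqrt y \<le> sqrt x + sqrt z + e"
    by (simp add: a_def b_def)
qed

text \<open>The weighted inequality is linear in the squared norms, so it survives each integration.
  Measurability of \<open>G\<close> and \<open>E\<close> serves to split the integral of the
  right-hand side, first over \<open>\<Omega>' w\<close> and then over
  \<open>\<Omega>\<close>.\<close>

lemma iterated_integral_le_weighted:
  fixes F G E :: "'w \<Rightarrow> 'v \<Rightarrow> 'k::real_normed_vector"
  assumes meas: "\<And>w. w \<in> space \<Omega> \<Longrightarrow> \<alpha> w \<in> borel_measurable (\<Omega>' w)"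
      "\<And>w. w \<in> space \<Omega> \<Longrightarrow> (\<lambda>v. norm (G w v)) \<in> borel_measurable (\<Omega>' w)"
      "\<And>w. w \<in> space \<Omega> \<Longrightarrow> (\<lambda>v. norm (E w v)) \<in> borel_measurable (\<Omega>' w)"
      "inner_integral \<Omega>' \<alpha> G \<in> borel_measurable \<Omega>"
      "inner_integral \<Omega>' \<alpha> E \<in> borel_measurable \<Omega>"
    and le: "\<And>w v. norm (F w v) \<le> norm (G w v) + norm (E w v)"
    and t: "0 < t"
  shows "iterated_integral \<Omega> \<Omega>' \<alpha> F \<le>
    ennreal (1 + t) * iterated_integral \<Omega> \<Omega>' \<alpha> G +
    ennreal (1 + 1 / t) * iterated_integral \<Omega> \<Omega>' \<alpha> E"
proof -
  have inner: "inner_integral \<Omega>' \<alpha> F w \<le>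
      ennreal (1 + t) * inner_integral \<Omega>' \<alpha> G w + ennreal (1 + 1 / t) * inner_integral \<Omega>' \<alpha> E w"
    if w: "w \<in> space \<Omega>" for w
  proof -
    note [measurable] = meas(1-3)[OF w]
    have pointwise: "ennreal ((\<alpha> w v)\<^sup>2 * (norm (F w v))\<^sup>2) \<le>
        ennreal (1 + t) * ennreal ((\<alpha> w v)\<^sup>2 * (norm (G w v))\<^sup>2) +
        ennreal (1 + 1 / t) * ennreal ((\<alpha> w v)\<^sup>2 * (norm (E w v))\<^sup>2)" for v
    proof -
      have "(norm (F w v))\<^sup>2 \<le> (norm (G w v) + norm (E w v))\<^sup>2"
        using le by (intro power_mono) auto
      also have "\<dots> \<le> (1 + t) * (norm (G w v))\<^sup>2 + (1 + 1 / t) * (norm (E w v))\<^sup>2"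
        using t by (rule power2_sum_le_weighted)
      finally have "(\<alpha> w v)\<^sup>2 * (norm (F w v))\<^sup>2 \<le>
          (\<alpha> w v)\<^sup>2 * ((1 + t) * (norm (G w v))\<^sup>2 + (1 + 1 / t) * (norm (E w v))\<^sup>2)"
        by (rule mult_left_mono) simp
      also have "\<dots> = (1 + t) * ((\<alpha> w v)\<^sup>2 * (norm (G w v))\<^sup>2) +
          (1 + 1 / t) * ((\<alpha> w v)\<^sup>2 * (norm (E w v))\<^sup>2)"
        by (simp only: distrib_left mult.left_commute)
      finally show ?thesis
        using t by (simp flip: ennreal_mult ennreal_plus add: ennreal_leI)
    qed
    have "inner_integral \<Omega>' \<alpha> F w \<le>
        (\<integral>\<^sup>+ v. ennreal (1 + t) * ennreal ((\<alpha> w v)\<^sup>2 * (norm (G w v))\<^sup>2) +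
          ennreal (1 + 1 / t) * ennreal ((\<alpha> w v)\<^sup>2 * (norm (E w v))\<^sup>2) \<partial>\<Omega>' w)"
      unfolding inner_integral_def by (intro nn_integral_mono pointwise)
    also have "\<dots> = ennreal (1 + t) * inner_integral \<Omega>' \<alpha> G w +
        ennreal (1 + 1 / t) * inner_integral \<Omega>' \<alpha> E w"
      unfolding inner_integral_def by (subst nn_integral_add) (simp_all add: nn_integral_cmult)
    finally show ?thesis .
  qed
  note [measurable] = meas(4,5)
  have "iterated_integral \<Omega> \<Omega>' \<alpha> F \<le>
      (\<integral>\<^sup>+ w. ennreal (1 + t) * inner_integral \<Omega>' \<alpha> G w +
        ennreal (1 + 1 / t) * inner_integral \<Omega>' \<alpha> E w \<partial>\<Omega>)"
    unfolding iterated_integral_def by (intro nn_integral_mono inner)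
  also have "\<dots> = ennreal (1 + t) * iterated_integral \<Omega> \<Omega>' \<alpha> G +
      ennreal (1 + 1 / t) * iterated_integral \<Omega> \<Omega>' \<alpha> E"
    unfolding iterated_integral_def by (subst nn_integral_add) (simp_all add: nn_integral_cmult)
  finally show ?thesis .
qed

text \<open>The pointwise hypothesis on norms, in place of an identity for \<open>F\<close>, fits
  both \<open>F = G - E\<close> and \<open>F = G + E\<close>. Finiteness is a separate conclusion
  because \<open>enn2real\<close> sends infinity to 0, so the inequality of roots alone would not
  exclude an infinite integral of \<open>F\<close>.\<close>

lemma iterated_integral_triangle:
  fixes F G E :: "'w \<Rightarrow> 'v \<Rightarrow> 'k::real_normed_vector"
  assumes "\<And>w. w \<in> space \<Omega> \<Longrightarrow> \<alpha> w \<in> borel_measurable (\<Omega>' w)"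
      "\<And>w. w \<in> space \<Omega> \<Longrightarrow> (\<lambda>v. norm (G w v)) \<in> borel_measurable (\<Omega>' w)"
      "\<And>w. w \<in> space \<Omega> \<Longrightarrow> (\<lambda>v. norm (E w v)) \<in> borel_measurable (\<Omega>' w)"
      "inner_integral \<Omega>' \<alpha> G \<in> borel_measurable \<Omega>"
      "inner_integral \<Omega>' \<alpha> E \<in> borel_measurable \<Omega>"
      "\<And>w v. norm (F w v) \<le> norm (G w v) + norm (E w v)"
    and fin: "iterated_integral \<Omega> \<Omega>' \<alpha> G < \<infinity>" "iterated_integral \<Omega> \<Omega>' \<alpha> E < \<infinity>"
  shows "iterated_integral \<Omega> \<Omega>' \<alpha> F < \<infinity>"
    and "sqrt (enn2real (iterated_integral \<Omega> \<Omega>' \<alpha> F)) \<le>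
      sqrt (enn2real (iterated_integral \<Omega> \<Omega>' \<alpha> G)) + sqrt (enn2real (iterated_integral \<Omega> \<Omega>' \<alpha> E))"
proof -
  let ?F = "iterated_integral \<Omega> \<Omega>' \<alpha> F"
  let ?G = "iterated_integral \<Omega> \<Omega>' \<alpha> G"
  let ?E = "iterated_integral \<Omega> \<Omega>' \<alpha> E"
  have weighted: "?F \<le> ennreal ((1 + t) * enn2real ?G + (1 + 1 / t) * enn2real ?E)"
    if t: "0 < t" for t
  proof -
    have "?F \<le> ennreal (1 + t) * ennreal (enn2real ?G) + ennreal (1 + 1 / t) * ennreal (enn2real ?E)"
      using iterated_integral_le_weighted[OF assms(1-6) t] fin by simp
    also have "\<dots> = ennreal ((1 + t) * enn2real ?G + (1 + 1 / t) * enn2real ?E)"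
      using t by (simp add: ennreal_mult ennreal_plus)
    finally show ?thesis .
  qed
  show "?F < \<infinity>"
    using weighted[of 1] by (auto intro: le_less_trans)
  show "sqrt (enn2real ?F) \<le> sqrt (enn2real ?G) + sqrt (enn2real ?E)"
  proof (rule sqrt_le_add_sqrt_if_weighted)
    fix t :: real
    assume "0 < t"
    then show "enn2real ?F \<le> (1 + t) * enn2real ?G + (1 + 1 / t) * enn2real ?E"
      using weighted[of t] by (intro enn2real_leI) auto
  qed simp_all
qed

section \<open>Frame bounds from scalar inequalities\<close>

lemma perturbed_frame_bounds:
  fixes x y d n A B C D \<epsilon> :: real
  assumes pos: "0 < A" "0 < B" "0 \<le> n" "0 \<le> y" "0 \<le> C" "0 \<le> D" "0 \<le> \<epsilon>"
    and less: "C + \<epsilon> / sqrt A < 1" "D < 1"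
    and x: "A * n\<^sup>2 \<le> x\<^sup>2" "x\<^sup>2 \<le> B * n\<^sup>2" "0 \<le> x"
    and triangle: "y \<le> x + d" "x \<le> y + d"
    and d: "d \<le> C * x + D * y + \<epsilon> * n"
  shows "A * ((1 - C - \<epsilon> / sqrt A) / (1 + D))\<^sup>2 * n\<^sup>2 \<le> y\<^sup>2"
    and "y\<^sup>2 \<le> B * ((1 + C + \<epsilon> / sqrt B) / (1 - D))\<^sup>2 * n\<^sup>2"
proof -
  \<comment> \<open>In the application \<open>x\<close>, \<open>y\<close> and \<open>d\<close> are
    the roots of the integrals for \<open>V\<close>, for \<open>Z\<close> and for their difference,
    and \<open>n\<close> is \<open>norm f\<close>.\<close>
  have An: "sqrt A * n \<le> x" and Bn: "x \<le> sqrt B * n"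
    using pos x by (auto intro!: power2_le_imp_le[of _ x] power2_le_imp_le[of x] simp: power_mult_distrib)
  \<comment> \<open>Writing the error term \<open>\<epsilon> * n\<close> as
    \<open>(\<epsilon> / sqrt A) * (sqrt A * n)\<close> absorbs it into the coefficient of the lower
    frame bound.\<close>
  have "(1 - C - \<epsilon> / sqrt A) * (sqrt A * n) = (1 - C) * (sqrt A * n) - \<epsilon> * n"
    using pos by (simp add: field_simps)
  \<comment> \<open>Multiplication by \<open>1 - C\<close> preserves the order, since
    \<open>C < 1\<close> follows from \<open>C + \<epsilon> / sqrt A < 1\<close> and
    \<open>0 \<le> \<epsilon>\<close>.\<close>
  also have "\<dots> \<le> (1 - C) * x - \<epsilon> * n"
  proof -
    have "0 \<le> \<epsilon> / sqrt A"
      using pos by simp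
    then show ?thesis
      using An less by (intro diff_right_mono mult_left_mono) auto
  qed
  \<comment> \<open>Insert the perturbation bound for \<open>d\<close> into
    \<open>x \<le> y + d\<close> and collect the terms in \<open>x\<close> and in
    \<open>y\<close>.\<close>
  also have "\<dots> \<le> (1 + D) * y"
    using triangle d by (simp add: algebra_simps)
  finally have lower: "sqrt A * ((1 - C - \<epsilon> / sqrt A) / (1 + D)) * n \<le> y"
    using pos by (simp add: pos_divide_le_eq mult_ac)
  have "(sqrt A * ((1 - C - \<epsilon> / sqrt A) / (1 + D)) * n)\<^sup>2 \<le> y\<^sup>2"
    using pos less by (intro power_mono lower) auto
  then show "A * ((1 - C - \<epsilon> / sqrt A) / (1 + D))\<^sup>2 * n\<^sup>2 \<le> y\<^sup>2"
    using pos by (simp only: power_mult_distrib real_sqrt_pow2 less_imp_le)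
  \<comment> \<open>The upper bound starts from the other triangle inequality,
    \<open>y \<le> x + d\<close>; here \<open>D < 1\<close> allows the later division by
    \<open>1 - D\<close>.\<close>
  have "(1 - D) * y \<le> (1 + C) * x + \<epsilon> * n"
    using triangle d by (simp add: algebra_simps)
  also have "\<dots> \<le> (1 + C) * (sqrt B * n) + \<epsilon> * n"
    using Bn pos by (intro add_right_mono mult_left_mono) auto
  also have "\<dots> = (1 + C + \<epsilon> / sqrt B) * (sqrt B * n)"
    using pos by (simp add: field_simps)
  finally have upper: "y \<le> sqrt B * ((1 + C + \<epsilon> / sqrt B) / (1 - D)) * n"
    using less by (simp add: pos_le_divide_eq mult_ac)
  have "y\<^sup>2 \<le> (sqrt B * ((1 + C + \<epsilon> / sqrt B) / (1 - D)) * n)\<^sup>2"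
    using pos by (intro power_mono upper) auto
  then show "y\<^sup>2 \<le> B * ((1 + C + \<epsilon> / sqrt B) / (1 - D))\<^sup>2 * n\<^sup>2"
    using pos by (simp only: power_mult_distrib real_sqrt_pow2 less_imp_le)
qed

lemma relay_analysis_strongly_measurable:
  assumes "relay_system \<Omega> \<Omega>' K W V \<Lambda> \<alpha>" "projections_measurable \<Omega> \<Omega>' K U" "w \<in> space \<Omega>"
  shows "strongly_measurable (\<Omega>' w) (relay_analysis W U \<Lambda> f w)"
proof -
  \<comment> \<open>\<open>projections_measurable\<close> speaks only of vectors in
    \<open>K w\<close>.\<close>
  have "\<Lambda> w (orth_proj (W w) f) \<in> K w"
    using assms unfolding relay_system_def by blast
  then show ?thesis
    using assms unfolding projections_measurable_def relay_analysis_def[abs_def] by blast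
qed

theorem theorem4p1:
  fixes \<Omega> :: "'w measure"
    and \<Omega>' :: "'w \<Rightarrow> 'v measure"
    and K :: "'w \<Rightarrow> 'k::{real_inner,complete_space} set"
    and W :: "'w \<Rightarrow> 'h::{real_inner,complete_space,second_countable_topology} set"
    and V Z :: "'w \<Rightarrow> 'v \<Rightarrow> 'k set"
    and \<Lambda> :: "'w \<Rightarrow> 'h \<Rightarrow> 'k"
    and \<alpha> :: "'w \<Rightarrow> 'v \<Rightarrow> real"
    and A B C D \<epsilon> :: real
  assumes frame: "continuous_relay_fusion_frame \<Omega> \<Omega>' K W V \<Lambda> \<alpha> A B"
    and Z_subspaces: "subspace_family \<Omega> \<Omega>' K Z"
    and Z_measurable: "projections_measurable \<Omega> \<Omega>' K Z"
    and Z_inner_measurable: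
      "\<And>f. inner_integral \<Omega>' \<alpha> (relay_analysis W Z \<Lambda> f) \<in> borel_measurable \<Omega>"
    and diff_inner_measurable:
      "\<And>f. inner_integral \<Omega>' \<alpha>
             (\<lambda>w v. relay_analysis W V \<Lambda> f w v - relay_analysis W Z \<Lambda> f w v) \<in> borel_measurable \<Omega>"
    and nonneg: "0 \<le> C" "0 \<le> D" "0 \<le> \<epsilon>"
    and max_less: "max (C + \<epsilon> / sqrt A) D < 1"
    and diff_finite:
      "\<And>f. iterated_integral \<Omega> \<Omega>' \<alpha>
             (\<lambda>w v. relay_analysis W V \<Lambda> f w v - relay_analysis W Z \<Lambda> f w v) < \<infinity>"
    and perturbation:
      "\<And>f. sqrt (enn2real (iterated_integral \<Omega> \<Omega>' \<alpha>
               (\<lambda>w v. relay_analysis W V \<Lambda> f w v - relay_analysis W Z \<Lambda> f w v)))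
           \<le> C * sqrt (enn2real (iterated_integral \<Omega> \<Omega>' \<alpha> (relay_analysis W V \<Lambda> f)))
             + D * sqrt (enn2real (iterated_integral \<Omega> \<Omega>' \<alpha> (relay_analysis W Z \<Lambda> f)))
             + \<epsilon> * norm f"
  shows "continuous_relay_fusion_frame \<Omega> \<Omega>' K W Z \<Lambda> \<alpha>
           (A * ((1 - C - \<epsilon> / sqrt A) / (1 + D))\<^sup>2)
           (B * ((1 + C + \<epsilon> / sqrt B) / (1 - D))\<^sup>2)"
proof -
  let ?V = "relay_analysis W V \<Lambda>"
  let ?Z = "relay_analysis W Z \<Lambda>"
  let ?d = "\<lambda>f w v. ?V f w v - ?Z f w v"
  let ?I = "iterated_integral \<Omega> \<Omega>' \<alpha>"
  let ?l = "(1 - C - \<epsilon> / sqrt A) / (1 + D)"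
  let ?u = "(1 + C + \<epsilon> / sqrt B) / (1 - D)"
  have system: "relay_system \<Omega> \<Omega>' K W V \<Lambda> \<alpha>"
    and V_measurable: "projections_measurable \<Omega> \<Omega>' K V"
    and V_inner: "inner_integral \<Omega>' \<alpha> (?V f) \<in> borel_measurable \<Omega>"
    and AB: "0 < A" "A \<le> B"
    and bounds: "ennreal (A * (norm f)\<^sup>2) \<le> ?I (?V f)" "?I (?V f) \<le> ennreal (B * (norm f)\<^sup>2)"
    for f
    using frame unfolding continuous_relay_fusion_frame_def by auto
  have less: "C + \<epsilon> / sqrt A < 1" "D < 1"
    using max_less by auto
  have \<alpha>: "\<And>w. w \<in> space \<Omega> \<Longrightarrow> \<alpha> w \<in> borel_measurable (\<Omega>' w)"
    using system unfolding relay_system_def by blast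
  note sm = relay_analysis_strongly_measurable[OF system]
  have normV: "(\<lambda>v. norm (?V f w v)) \<in> borel_measurable (\<Omega>' w)"
    and normZ: "(\<lambda>v. norm (?Z f w v)) \<in> borel_measurable (\<Omega>' w)"
    and normd: "(\<lambda>v. norm (?d f w v)) \<in> borel_measurable (\<Omega>' w)"
    if "w \<in> space \<Omega>" for f w
    using that sm[OF V_measurable] sm[OF Z_measurable]
    by (auto intro!: strongly_measurable_norm strongly_measurable_diff)
  have Z_bounds: "ennreal (A * ?l\<^sup>2 * (norm f)\<^sup>2) \<le> ?I (?Z f)"
    "?I (?Z f) \<le> ennreal (B * ?u\<^sup>2 * (norm f)\<^sup>2)" for f
  proof -
    have V_fin: "?I (?V f) < \<infinity>"
      using bounds(2)[of f] by (auto intro: le_less_trans)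
    have tri: "norm (?Z f w v) \<le> norm (?V f w v) + norm (?d f w v)"
      "norm (?V f w v) \<le> norm (?Z f w v) + norm (?d f w v)" for w v
      using norm_triangle_ineq4[of "?V f w v" "?d f w v"] norm_triangle_ineq[of "?Z f w v" "?d f w v"]
      by simp_all
    \<comment> \<open>The order matters: the first application, to \<open>?Z = ?V - ?d\<close>,
      yields finiteness of the integral for \<open>?Z f\<close>, which the second one, to
      \<open>?V = ?Z + ?d\<close>, takes as a premise.\<close>
    note Z_le = iterated_integral_triangle[where F = "?Z f", OF \<alpha> normV normd V_inner
        diff_inner_measurable tri(1) V_fin diff_finite]
    note V_le = iterated_integral_triangle(2)[where F = "?V f", OF \<alpha> normZ normd Z_inner_measurable
        diff_inner_measurable tri(2) Z_le(1) diff_finite]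
    \<comment> \<open>These are the integrals themselves; their roots take the places of
      \<open>x\<close> and \<open>y\<close> in the scalar lemma.\<close>
    define x y where "x = enn2real (?I (?V f))" and "y = enn2real (?I (?Z f))"
    have real: "?I (?V f) = ennreal x" "?I (?Z f) = ennreal y" and nn: "0 \<le> x" "0 \<le> y"
      using V_fin Z_le(1) by (simp_all add: x_def y_def)
    have V_real: "A * (norm f)\<^sup>2 \<le> x" "x \<le> B * (norm f)\<^sup>2"
      using bounds[of f] AB nn by (simp_all add: real)
    have "A * ?l\<^sup>2 * (norm f)\<^sup>2 \<le> (sqrt y)\<^sup>2" "(sqrt y)\<^sup>2 \<le> B * ?u\<^sup>2 * (norm f)\<^sup>2"
      using perturbed_frame_bounds[of A B "norm f" "sqrt y" C D \<epsilon> "sqrt x"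
          "sqrt (enn2real (?I (?d f)))"]
        AB nonneg less V_real nn Z_le(2) V_le perturbation[of f]
      unfolding x_def[symmetric] y_def[symmetric] by simp_all
    then show "ennreal (A * ?l\<^sup>2 * (norm f)\<^sup>2) \<le> ?I (?Z f)"
      "?I (?Z f) \<le> ennreal (B * ?u\<^sup>2 * (norm f)\<^sup>2)"
      using nn by (simp_all add: real ennreal_leI)
  qed
  have \<epsilon>: "0 \<le> \<epsilon> / sqrt A" "0 \<le> \<epsilon> / sqrt B"
    using AB nonneg by simp_all
  \<comment> \<open>The order of the new bounds cannot be read off from \<open>Z_bounds\<close> when
    the space is trivial. It comes from \<open>?l \<le> 1 \<le> ?u\<close> and
    \<open>A \<le> B\<close>.\<close>
  have l: "0 < ?l" "?l \<le> 1" and u: "1 \<le> ?u"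
    using \<epsilon> nonneg less by (auto simp: pos_divide_le_eq pos_le_divide_eq)
  have "A * ?l\<^sup>2 \<le> A * 1" "B * 1 \<le> B * ?u\<^sup>2"
    using AB l u by (auto intro!: mult_left_mono simp: power_le_one)
  then have "A * ?l\<^sup>2 \<le> B * ?u\<^sup>2"
    using AB by linarith
  moreover have "0 < A * ?l\<^sup>2"
    using AB(1) l(1) by (intro mult_pos_pos zero_less_power)
  moreover have "relay_system \<Omega> \<Omega>' K W Z \<Lambda> \<alpha>"
    using system Z_subspaces unfolding relay_system_def by blast
  ultimately show ?thesis
    using frame Z_measurable Z_inner_measurable Z_bounds
    unfolding continuous_relay_fusion_frame_def by blast
qed

end
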